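(* Let $c,\phi\in\mathbb{R}$ with $\phi\neq0$, and let $K(s)$ be a continuous function on an interval in $(0,\infty)$ containing $s_0$. Then there exists a 2-parameter family of pseudo-isotropic helicoidal surfaces of i-type in $\mathbb{I}^3_{\mathrm{p}}$ with $K$ as the Gaussian curvature (i.e. the Gaussian curvature at the point with parameters $(s,t)$ is $K(s)$) and whose generating curves $\alpha_{k_0,k_1}(s)=(s,0,z(s))$, or $\alpha_{k_0,k_1}(s)=(0,s,z(s))$, where $s>0$ is an arc-length parameter, satisfy, on intervals around $s_0$ on which the quantity under the square root is positive, $$z(s)=k_0+\int_{s_0}^{s}\left(k_1+\frac{c^2}{\phi^2v^2}+2\int_{s_0}^{v}w\,K(w)\,dw\right)^{\frac12}dv,$$ where $k_0,k_1$ are constants depending on the values of $z,z'$ at $s=s_0$. (The assertion holds for each of the two kinds of generating curve.)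
   Context: The pseudo-isotropic space $\mathbb{I}^3_{\mathrm{p}}$ is $\mathbb{R}^3$ with the degenerate metric $\langle u,v\rangle_{pz}=u^1v^1-u^2v^2$. For a $C^2$ parameterized surface $\mathbf{x}(u^1,u^2)=(x^1,x^2,x^3)$ write $\mathbf{x}_i=\partial\mathbf{x}/\partial u^i$, $\mathbf{x}_{ij}=\partial^2\mathbf{x}/\partial u^i\partial u^j$, $x^i_k=\partial x^i/\partial u^k$, $X_{ij}=x^i_1x^j_2-x^j_1x^i_2$. The surface is admissible if $X_{12}\neq0$ (equivalently, the induced metric has rank 2). Put $g_{ij}=\langle\mathbf{x}_i,\mathbf{x}_j\rangle_{pz}$, $N_h=\left(\frac{X_{23}}{X_{12}},\frac{X_{13}}{X_{12}},1\right)$, $h_{ij}=\langle N_h,\mathbf{x}_{ij}\rangle_1$, where $\langle u,v\rangle_1=u^1v^1-u^2v^2+u^3v^3$. The Gaussian and mean curvatures are $$K=\frac{h_{11}h_{22}-h_{12}^2}{g_{11}g_{22}-g_{12}^2},\qquad H=\frac12\,\frac{g_{11}h_{22}-2g_{12}h_{12}+g_{22}h_{11}}{g_{11}g_{22}-g_{12}^2};$$ equivalently $K=\det L$, $H=\frac12\mathrm{tr}\,L$ with $L=-D\xi^{\mathrm p}$, $\xi^{\mathrm p}=\left(A,B,\frac12(1-A^2+B^2)\right)$, $A=X_{23}/X_{12}$, $B=X_{13}/X_{12}$. The helicoidal surfaces of i-type with parameters $c,\phi$ are, with coordinates $(u^1,u^2)=(u,t)$ and $C^2$ generating curve $\alpha$: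 for $\alpha(u)=(x(u),0,z(u))$ (spacelike), $$Zh_2(u,t)=(x(u)\cosh(t\phi),\ x(u)\sinh(t\phi),\ z(u)+ct),$$ and for $\alpha(u)=(0,y(u),z(u))$ (timelike), $$Wh_2(u,t)=(y(u)\sinh(t\phi),\ y(u)\cosh(t\phi),\ z(u)+ct).$$ Surfaces are assumed admissible, i.e. $\phi xx'\neq0$, respectively $\phi yy'\neq0$. *)

theory Defs
  imports "HOL-Analysis.Analysis"
begin

text \<open>Parameters live in \<open>real^2\<close>, the ambient space is \<open>real^3\<close>. All derivatives are taken
  within the parameter domain, so a domain may contain boundary points (where derivatives are
  one-sided); at interior points these are the ordinary derivatives. The notions below are
  meaningful when no coordinate slice of the domain has an isolated point, e.g. for open sets and
  for products of nondegenerate intervals.\<close>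

definition pz_inner :: "real^3 \<Rightarrow> real^3 \<Rightarrow> real" where
  "pz_inner u v = u$1 * v$1 - u$2 * v$2"

definition inner1 :: "real^3 \<Rightarrow> real^3 \<Rightarrow> real" where
  "inner1 u v = u$1 * v$1 - u$2 * v$2 + u$3 * v$3"

definition coord_slice :: "(real^2) set \<Rightarrow> real^2 \<Rightarrow> 2 \<Rightarrow> real set" where
  "coord_slice D p i = {h. p + h *\<^sub>R axis i 1 \<in> D}"

definition pder :: "(real^2) set \<Rightarrow> (real^2 \<Rightarrow> real^3) \<Rightarrow> 2 \<Rightarrow> real^2 \<Rightarrow> real^3" where
  "pder D f i p =
     vector_derivative (\<lambda>h. f (p + h *\<^sub>R axis i 1)) (at 0 within coord_slice D p i)"

definition pder2 :: "(real^2) set \<Rightarrow> (real^2 \<Rightarrow> real^3) \<Rightarrow> 2 \<Rightarrow> 2 \<Rightarrow> real^2 \<Rightarrow> real^3" where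
  "pder2 D f i j = pder D (pder D f i) j"

definition C1_surface_on :: "(real^2) set \<Rightarrow> (real^2 \<Rightarrow> real^3) \<Rightarrow> bool" where
  "C1_surface_on D f \<longleftrightarrow> continuous_on D f \<and>
     (\<forall>i. (\<forall>p\<in>D. (\<lambda>h. f (p + h *\<^sub>R axis i 1)) differentiable (at 0 within coord_slice D p i))
          \<and> continuous_on D (pder D f i))"

definition C2_surface_on :: "(real^2) set \<Rightarrow> (real^2 \<Rightarrow> real^3) \<Rightarrow> bool" where
  "C2_surface_on D f \<longleftrightarrow> C1_surface_on D f \<and> (\<forall>i. C1_surface_on D (pder D f i))"

definition Xmin :: "(real^2) set \<Rightarrow> (real^2 \<Rightarrow> real^3) \<Rightarrow> 3 \<Rightarrow> 3 \<Rightarrow> real^2 \<Rightarrow> real" where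
  "Xmin D f i j p =
     pder D f 1 p $ i * pder D f 2 p $ j - pder D f 1 p $ j * pder D f 2 p $ i"

definition admissible_surface_on :: "(real^2) set \<Rightarrow> (real^2 \<Rightarrow> real^3) \<Rightarrow> bool" where
  "admissible_surface_on D f \<longleftrightarrow> C2_surface_on D f \<and> (\<forall>p\<in>D. Xmin D f 1 2 p \<noteq> 0)"

definition gcoef :: "(real^2) set \<Rightarrow> (real^2 \<Rightarrow> real^3) \<Rightarrow> 2 \<Rightarrow> 2 \<Rightarrow> real^2 \<Rightarrow> real" where
  "gcoef D f i j p = pz_inner (pder D f i p) (pder D f j p)"

definition Nh :: "(real^2) set \<Rightarrow> (real^2 \<Rightarrow> real^3) \<Rightarrow> real^2 \<Rightarrow> real^3" where
  "Nh D f p = vector [Xmin D f 2 3 p / Xmin D f 1 2 p, Xmin D f 1 3 p / Xmin D f 1 2 p, 1]"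

definition hcoef :: "(real^2) set \<Rightarrow> (real^2 \<Rightarrow> real^3) \<Rightarrow> 2 \<Rightarrow> 2 \<Rightarrow> real^2 \<Rightarrow> real" where
  "hcoef D f i j p = inner1 (Nh D f p) (pder2 D f i j p)"

definition gauss_curvature :: "(real^2) set \<Rightarrow> (real^2 \<Rightarrow> real^3) \<Rightarrow> real^2 \<Rightarrow> real" where
  "gauss_curvature D f p =
     (hcoef D f 1 1 p * hcoef D f 2 2 p - (hcoef D f 1 2 p)\<^sup>2) /
     (gcoef D f 1 1 p * gcoef D f 2 2 p - (gcoef D f 1 2 p)\<^sup>2)"

definition velocity :: "real set \<Rightarrow> (real \<Rightarrow> real^3) \<Rightarrow> real \<Rightarrow> real^3" where
  "velocity J \<alpha> s = vector_derivative \<alpha> (at s within J)"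

definition C2_curve_on :: "real set \<Rightarrow> (real \<Rightarrow> real^3) \<Rightarrow> bool" where
  "C2_curve_on J \<alpha> \<longleftrightarrow> \<alpha> differentiable_on J \<and> velocity J \<alpha> differentiable_on J \<and>
     continuous_on J (velocity J (velocity J \<alpha>))"

text \<open>Absolute value, since timelike curves have velocity of square \<open>-1\<close>.\<close>

definition arc_length_on :: "real set \<Rightarrow> (real \<Rightarrow> real^3) \<Rightarrow> bool" where
  "arc_length_on J \<alpha> \<longleftrightarrow> (\<forall>s\<in>J. \<bar>pz_inner (velocity J \<alpha> s) (velocity J \<alpha> s)\<bar> = 1)"

text \<open>The helicoidal surface generated by a curve \<open>\<alpha> = (x, 0, z)\<close>, resp. \<open>\<alpha> = (0, y, z)\<close>; the
  vanishing coordinate of \<open>\<alpha>\<close> is not used.\<close>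

definition Zh2 :: "real \<Rightarrow> real \<Rightarrow> (real \<Rightarrow> real^3) \<Rightarrow> real^2 \<Rightarrow> real^3" where
  "Zh2 c \<phi> \<alpha> p = vector [\<alpha> (p$1) $ 1 * cosh (p$2 * \<phi>), \<alpha> (p$1) $ 1 * sinh (p$2 * \<phi>),
                          \<alpha> (p$1) $ 3 + c * p$2]"

definition Wh2 :: "real \<Rightarrow> real \<Rightarrow> (real \<Rightarrow> real^3) \<Rightarrow> real^2 \<Rightarrow> real^3" where
  "Wh2 c \<phi> \<alpha> p = vector [\<alpha> (p$1) $ 2 * sinh (p$2 * \<phi>), \<alpha> (p$1) $ 2 * cosh (p$2 * \<phi>),
                          \<alpha> (p$1) $ 3 + c * p$2]"

definition strip :: "real set \<Rightarrow> (real^2) set" where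
  "strip J = {p. p$1 \<in> J}"

definition radicand :: "real \<Rightarrow> real \<Rightarrow> (real \<Rightarrow> real) \<Rightarrow> real \<Rightarrow> real \<Rightarrow> real \<Rightarrow> real" where
  "radicand c \<phi> K s0 k1 v = k1 + c\<^sup>2 / (\<phi>\<^sup>2 * v\<^sup>2) + 2 * (LBINT w=s0..v. w * K w)"

text \<open>Nondegenerate intervals \<open>J \<subseteq> I\<close> containing \<open>s0\<close> on which the generating curve is defined.\<close>

definition good_interval ::
    "real \<Rightarrow> real \<Rightarrow> (real \<Rightarrow> real) \<Rightarrow> real set \<Rightarrow> real \<Rightarrow> real \<Rightarrow> real set \<Rightarrow> bool" where
  "good_interval c \<phi> K I s0 k1 J \<longleftrightarrow>
     is_interval J \<and> J \<subseteq> I \<and> s0 \<in> J \<and> J \<noteq> {s0} \<and> (\<forall>v\<in>J. radicand c \<phi> K s0 k1 v > 0)"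

end

theory Submission
  imports Defs
begin

text \<open>
  Write both kinds of surfaces as \<open>(s a(t), s b(t), z(s) + c t)\<close>, where \<open>a' = \<phi> b\<close>,
  \<open>b' = \<phi> a\<close> and \<open>a\<^sup>2 - b\<^sup>2 = \<epsilon>\<close> is constant: \<open>(a, b) = (cosh, sinh)\<close> with \<open>\<epsilon> = 1\<close> for a
  spacelike generating curve, and \<open>(a, b) = (sinh, cosh)\<close> with \<open>\<epsilon> = -1\<close> for a timelike one. One
  computation covers both, because the curvature depends on \<open>\<epsilon>\<close> only through \<open>\<epsilon>\<^sup>2 = 1\<close>. The
  coordinate curves are orthogonal, and
  \<open>g\<^sub>1\<^sub>1 = \<epsilon>\<close>, \<open>g\<^sub>2\<^sub>2 = - \<epsilon> s\<^sup>2 \<phi>\<^sup>2\<close>, \<open>h\<^sub>1\<^sub>1 = z''\<close>, \<open>h\<^sub>1\<^sub>2 = - c / s\<close>, \<open>h\<^sub>2\<^sub>2 = - s \<phi>\<^sup>2 z'\<close>,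
  so that the Gaussian curvature is \<open>z' z'' / s + c\<^sup>2 / (\<phi>\<^sup>2 s\<^sup>4)\<close>
  (\<open>helicoid_admissible_gauss_curvature\<close>).

  Prescribing the curvature \<open>K\<close> is therefore the equation
  \<open>(z'\<^sup>2)' = 2 z' z'' = 2 s K - 2 c\<^sup>2 / (\<phi>\<^sup>2 s\<^sup>3)\<close>, which is linear in \<open>z'\<^sup>2\<close>. Its solutions are
  \<open>z'\<^sup>2 = radicand\<close>, with \<open>k1\<close> the constant of integration; where the radicand is positive, its
  square root is continuously differentiable, and a second integration gives \<open>z\<close>, with additive
  constant \<open>k0\<close>.

  The remaining work is analytic. The domain \<open>J\<close> may contain its end points, so the fundamental
  theorem of calculus is needed for derivatives within an arbitrary nondegenerate interval
  (\<open>interval_integral_has_real_derivative\<close>), and partial derivatives within the strip over \<open>J\<close> have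
  to be reduced to derivatives of one variable (\<open>C1_surface_on_strip\<close>).
\<close>

section \<open>Calculus on intervals and vectors of length three\<close>

lemma vector3_eq_axis:
  "(vector [a, b, c] :: real^3) = a *\<^sub>R axis 1 1 + b *\<^sub>R axis 2 1 + c *\<^sub>R axis 3 1"
  by (simp add: vec_eq_iff forall_3 axis_def)

lemma has_vector_derivative_vector3:
  assumes "(f has_real_derivative f') (at x within S)"
    and "(g has_real_derivative g') (at x within S)"
    and "(h has_real_derivative h') (at x within S)"
  shows "((\<lambda>x. vector [f x, g x, h x] :: real^3) has_vector_derivative vector [f', g', h'])
           (at x within S)"
  unfolding vector3_eq_axis using assms
  by (auto intro!: derivative_eq_intros simp: has_real_derivative_iff_has_vector_derivative[symmetric])

lemma continuous_on_vector3:
  fixes f g h :: "'a::topological_space \<Rightarrow> real"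
  assumes "continuous_on S f" "continuous_on S g" "continuous_on S h"
  shows "continuous_on S (\<lambda>x. vector [f x, g x, h x] :: real^3)"
  unfolding vector3_eq_axis using assms by (intro continuous_intros)

text \<open>A derivative taken within a set is unique only at limit points of the set; this is where the
  nondegeneracy of the parameter interval enters.\<close>

lemma interval_islimpt:
  fixes J :: "real set"
  assumes "is_interval J" "s0 \<in> J" "J \<noteq> {s0}" "s \<in> J"
  shows "at s within J \<noteq> bot"
proof -
  have "s islimpt J"
    using assms by (intro connected_imp_perfect) (auto simp: is_interval_connected)
  then show ?thesis by (simp add: trivial_limit_within)
qed

text \<open>The fundamental theorem of calculus is about compact intervals, while an interval \<open>J\<close> may be open
  or unbounded at either end. Being a derivative at \<open>s\<close> within \<open>J\<close> is a local property, so it suffices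
  to replace \<open>J\<close> by a compact piece that coincides with it near \<open>s\<close>; the piece also has to reach
  \<open>s0\<close>, where the integrals start.\<close>

lemma interval_at_within_compact:
  fixes J :: "real set"
  assumes J: "is_interval J" and "s0 \<in> J" "s \<in> J"
  obtains a b where "a \<le> s0" "s0 \<le> b" "a \<le> s" "s \<le> b" "{a..b} \<subseteq> J"
    "at s within J = at s within {a..b}"
proof -
  \<comment> \<open>Go beyond \<open>s\<close> on each side, except where \<open>s\<close> is an end point of \<open>J\<close>.\<close>
  obtain b where b: "b \<in> J" "s \<le> b" "b = s \<longrightarrow> (\<forall>y\<in>J. y \<le> s)"
    using \<open>s \<in> J\<close> by (metis linorder_le_cases order_refl)
  obtain a where a: "a \<in> J" "a \<le> s" "a = s \<longrightarrow> (\<forall>y\<in>J. s \<le> y)"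
    using \<open>s \<in> J\<close> by (metis linorder_le_cases order_refl)
  define A B where "A = min a s0" and "B = max b s0"
  have AB: "A \<in> J" "B \<in> J" using a b assms by (auto simp: A_def B_def min_def max_def)
  have sub: "{A..B} \<subseteq> J"
    using J AB unfolding is_interval_1 by (meson atLeastAtMost_iff subsetI)
  define S where "S = {y. (a < s \<longrightarrow> a < y) \<and> (s < b \<longrightarrow> y < b)}"
  have "S = (if a < s then {a<..} else UNIV) \<inter> (if s < b then {..<b} else UNIV)"
    by (auto simp: S_def)
  moreover have "open (if a < s then {a<..} else UNIV)" "open (if s < b then {..<b} else UNIV)"
    by simp_all
  ultimately have "open S" by (metis open_Int)
  moreover have "s \<in> S" by (simp add: S_def)
  moreover have "J \<inter> S - {s} = {A..B} \<inter> S - {s}"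
  proof -
    have "a \<le> y \<and> y \<le> b" if "y \<in> J" "y \<in> S" for y
      using that a b by (cases "a = s"; cases "b = s") (auto simp: S_def less_le)
    then have "y \<in> {A..B}" if "y \<in> J" "y \<in> S" for y
      using that by (auto simp: A_def B_def min_le_iff_disj le_max_iff_disj)
    then show ?thesis using sub by blast
  qed
  ultimately have "at s within J = at s within {A..B}" by (intro at_within_nhd) auto
  then show ?thesis using that[of A B] a b sub by (simp add: A_def B_def)
qed

lemma interval_integral_has_real_derivative:
  fixes f :: "real \<Rightarrow> real"
  assumes "is_interval J" "s0 \<in> J" "s \<in> J" "continuous_on J f"
  shows "((\<lambda>v. LBINT w=s0..v. f w) has_real_derivative f s) (at s within J)"
proof -
  obtain a b where ab: "a \<le> s0" "s0 \<le> b" "a \<le> s" "s \<le> b" "{a..b} \<subseteq> J"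
    "at s within J = at s within {a..b}"
    using interval_at_within_compact[OF assms(1-3)] by blast
  have "((\<lambda>v. LBINT w=s0..v. f w) has_vector_derivative f s) (at s within {a..b})"
    using ab continuous_on_subset[OF assms(4)] by (intro interval_integral_FTC2) auto
  then show ?thesis using ab(6) by (simp add: has_real_derivative_iff_has_vector_derivative)
qed

section \<open>Partial derivatives on a strip\<close>

lemma strip_shift_1: "p + h *\<^sub>R axis 1 1 \<in> strip J \<longleftrightarrow> p $ 1 + h \<in> J"
  by (simp add: strip_def axis_def)

lemma strip_shift_2: "p + h *\<^sub>R axis 2 1 \<in> strip J \<longleftrightarrow> p $ 1 \<in> J"
  by (simp add: strip_def axis_def)

text \<open>Partial derivatives are taken in the increment \<open>h\<close> at \<open>0\<close>, along a slice of the domain. The next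
  two lemmas move this to the base point, where the one-variable calculus applies.\<close>

lemma has_vector_derivative_shift:
  fixes g :: "real \<Rightarrow> 'a::real_normed_vector"
  assumes "(g has_vector_derivative d) (at s within J)"
  shows "((\<lambda>h. g (s + h)) has_vector_derivative d) (at 0 within {h. s + h \<in> J})"
proof -
  have im: "(\<lambda>h. s + h) ` {h. s + h \<in> J} \<subseteq> J" by auto
  have "((\<lambda>h. s + h) has_vector_derivative 1) (at 0 within {h. s + h \<in> J})"
    by (auto intro!: derivative_eq_intros)
  moreover have "(g has_vector_derivative d) (at (s + 0) within (\<lambda>h. s + h) ` {h. s + h \<in> J})"
    using has_vector_derivative_within_subset[OF assms im] by simp
  ultimately have "(g \<circ> (\<lambda>h. s + h) has_vector_derivative 1 *\<^sub>R d) (at 0 within {h. s + h \<in> J})"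
    by (rule vector_diff_chain_within)
  then show ?thesis by (simp add: o_def)
qed

lemma shifted_at_within_neq_bot:
  fixes s :: real
  assumes "at s within J \<noteq> bot"
  shows "at 0 within {h. s + h \<in> J} \<noteq> bot"
proof -
  have *: "s islimpt J" using assms by (simp add: trivial_limit_within)
  have "0 islimpt {h. s + h \<in> J}"
    unfolding islimpt_approachable
  proof (intro allI impI)
    fix e :: real assume "e > 0"
    then obtain y where "y \<in> J" "y \<noteq> s" "dist y s < e"
      using * unfolding islimpt_approachable by blast
    then show "\<exists>h\<in>{h. s + h \<in> J}. h \<noteq> 0 \<and> dist h 0 < e"
      by (intro bexI[of _ "y - s"]) (auto simp: dist_real_def)
  qed
  then show ?thesis by (simp add: trivial_limit_within)
qed

text \<open>Agreement of \<open>g\<close> with \<open>F\<close> is demanded only on the strip, so that these lemmas apply again with a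
  partial derivative as \<open>g\<close>, whose values are known only there.\<close>

lemma pder_strip_1:
  assumes perfect: "at (p $ 1) within J \<noteq> bot"
    and agree: "\<And>q. q \<in> strip J \<Longrightarrow> g q = F (q $ 1) (q $ 2)"
    and p: "p \<in> strip J"
    and deriv: "((\<lambda>s. F s (p $ 2)) has_vector_derivative d) (at (p $ 1) within J)"
  shows "(\<lambda>h. g (p + h *\<^sub>R axis 1 1)) differentiable (at 0 within coord_slice (strip J) p 1)"
    and "pder (strip J) g 1 p = d"
proof -
  have slice: "coord_slice (strip J) p 1 = {h. p $ 1 + h \<in> J}"
    by (simp add: coord_slice_def strip_shift_1)
  have "((\<lambda>h. g (p + h *\<^sub>R axis 1 1)) has_vector_derivative d)
          (at 0 within {h. p $ 1 + h \<in> J})"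
  proof (rule has_vector_derivative_transform)
    show "0 \<in> {h. p $ 1 + h \<in> J}" using p by (simp add: strip_def)
    show "((\<lambda>h. F (p $ 1 + h) (p $ 2)) has_vector_derivative d)
            (at 0 within {h. p $ 1 + h \<in> J})"
      by (rule has_vector_derivative_shift[OF deriv])
    fix h assume "h \<in> {h. p $ 1 + h \<in> J}"
    then show "g (p + h *\<^sub>R axis 1 1) = F (p $ 1 + h) (p $ 2)"
      by (subst agree) (auto simp: strip_shift_1, simp add: axis_def)
  qed
  then show "(\<lambda>h. g (p + h *\<^sub>R axis 1 1)) differentiable (at 0 within coord_slice (strip J) p 1)"
    and "pder (strip J) g 1 p = d"
    unfolding pder_def slice
    using shifted_at_within_neq_bot[OF perfect]
    by (auto intro: differentiableI_vector vector_derivative_within)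
qed

lemma pder_strip_2:
  assumes agree: "\<And>q. q \<in> strip J \<Longrightarrow> g q = F (q $ 1) (q $ 2)"
    and p: "p \<in> strip J"
    and deriv: "(F (p $ 1) has_vector_derivative d) (at (p $ 2))"
  shows "(\<lambda>h. g (p + h *\<^sub>R axis 2 1)) differentiable (at 0 within coord_slice (strip J) p 2)"
    and "pder (strip J) g 2 p = d"
proof -
  have slice: "coord_slice (strip J) p 2 = UNIV"
    using p by (simp add: coord_slice_def strip_shift_2) (simp add: strip_def)
  have "g (p + h *\<^sub>R axis 2 1) = F (p $ 1) (p $ 2 + h)" for h
    using p by (subst agree) (simp_all add: strip_shift_2, simp_all add: strip_def axis_def)
  then have "((\<lambda>h. g (p + h *\<^sub>R axis 2 1)) has_vector_derivative d) (at 0)"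
    using has_vector_derivative_shift[OF deriv] by simp
  then show "(\<lambda>h. g (p + h *\<^sub>R axis 2 1)) differentiable (at 0 within coord_slice (strip J) p 2)"
    and "pder (strip J) g 2 p = d"
    unfolding pder_def slice
    by (auto intro: differentiableI_vector vector_derivative_at)
qed

lemma C1_surface_on_strip:
  fixes F F1 F2 :: "real \<Rightarrow> real \<Rightarrow> real^3"
  assumes perfect: "\<And>s. s \<in> J \<Longrightarrow> at s within J \<noteq> bot"
    and agree: "\<And>q. q \<in> strip J \<Longrightarrow> g q = F (q $ 1) (q $ 2)"
    and d1: "\<And>s t. s \<in> J \<Longrightarrow> ((\<lambda>s. F s t) has_vector_derivative F1 s t) (at s within J)"
    and d2: "\<And>s t. s \<in> J \<Longrightarrow> (F s has_vector_derivative F2 s t) (at t)"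
    and c0: "continuous_on (strip J) (\<lambda>p. F (p $ 1) (p $ 2))"
    and c1: "continuous_on (strip J) (\<lambda>p. F1 (p $ 1) (p $ 2))"
    and c2: "continuous_on (strip J) (\<lambda>p. F2 (p $ 1) (p $ 2))"
  shows "C1_surface_on (strip J) g"
    and "\<And>q. q \<in> strip J \<Longrightarrow> pder (strip J) g 1 q = F1 (q $ 1) (q $ 2)"
    and "\<And>q. q \<in> strip J \<Longrightarrow> pder (strip J) g 2 q = F2 (q $ 1) (q $ 2)"
proof -
  have inJ: "q $ 1 \<in> J" if "q \<in> strip J" for q using that by (simp add: strip_def)
  have P1: "(\<lambda>h. g (q + h *\<^sub>R axis 1 1)) differentiable (at 0 within coord_slice (strip J) q 1)"
      "pder (strip J) g 1 q = F1 (q $ 1) (q $ 2)" if "q \<in> strip J" for q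
    using pder_strip_1[of q J g F, OF perfect[OF inJ[OF that]] agree that d1[OF inJ[OF that]]]
    by simp_all
  have P2: "(\<lambda>h. g (q + h *\<^sub>R axis 2 1)) differentiable (at 0 within coord_slice (strip J) q 2)"
      "pder (strip J) g 2 q = F2 (q $ 1) (q $ 2)" if "q \<in> strip J" for q
    using pder_strip_2[of J g F, OF agree that d2[OF inJ[OF that]]]
    by simp_all
  show p1: "pder (strip J) g 1 q = F1 (q $ 1) (q $ 2)" if "q \<in> strip J" for q
    by (rule P1(2)[OF that])
  show p2: "pder (strip J) g 2 q = F2 (q $ 1) (q $ 2)" if "q \<in> strip J" for q
    by (rule P2(2)[OF that])
  have "continuous_on (strip J) g" using c0 by (subst continuous_on_cong[OF refl agree])
  moreover have "continuous_on (strip J) (pder (strip J) g 1)"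
    using c1 by (subst continuous_on_cong[OF refl p1])
  moreover have "continuous_on (strip J) (pder (strip J) g 2)"
    using c2 by (subst continuous_on_cong[OF refl p2])
  ultimately show "C1_surface_on (strip J) g"
    unfolding C1_surface_on_def forall_2 by (intro conjI ballI P1(1) P2(1))
qed

section \<open>The curvature of a helicoidal surface\<close>

text \<open>The condition on \<open>a\<close> and \<open>b\<close> is that \<open>t\<close> acts by hyperbolic rotations, so all coefficients of the two
  fundamental forms lose their dependence on \<open>t\<close> through \<open>a\<^sup>2 - b\<^sup>2 = \<epsilon>\<close>. The surface is admissible
  because \<open>X\<^sub>1\<^sub>2 = \<epsilon> s \<phi>\<close> does not vanish off \<open>s = 0\<close>.\<close>

lemma helicoid_admissible_gauss_curvature:
  fixes a b z z1 z2 :: "real \<Rightarrow> real" and c \<phi> \<epsilon> :: real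
  assumes perfect: "\<And>s. s \<in> J \<Longrightarrow> at s within J \<noteq> bot" and "0 \<notin> J" and "\<phi> \<noteq> 0"
    and da: "\<And>t. (a has_real_derivative \<phi> * b t) (at t)"
    and db: "\<And>t. (b has_real_derivative \<phi> * a t) (at t)"
    and unit: "\<And>t. (a t)\<^sup>2 - (b t)\<^sup>2 = \<epsilon>" and eps: "\<epsilon>\<^sup>2 = 1"
    and dz: "\<And>s. s \<in> J \<Longrightarrow> (z has_real_derivative z1 s) (at s within J)"
    and dz1: "\<And>s. s \<in> J \<Longrightarrow> (z1 has_real_derivative z2 s) (at s within J)"
    and cz2: "continuous_on J z2"
    and f: "\<And>p. f p = vector [p $ 1 * a (p $ 2), p $ 1 * b (p $ 2), z (p $ 1) + c * p $ 2]"
  shows "admissible_surface_on (strip J) f"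
    and "\<And>s t. s \<in> J \<Longrightarrow>
           gauss_curvature (strip J) f (vector [s, t]) = z1 s * z2 s / s + c\<^sup>2 / (\<phi>\<^sup>2 * s ^ 4)"
proof -
  let ?S = "strip J"
  have ca: "continuous_on A (\<lambda>p. a (p $ 2))" and cb: "continuous_on A (\<lambda>p. b (p $ 2))"
    for A :: "(real^2) set"
    using da db
    by (auto intro!: continuous_on_compose2[of UNIV a] continuous_on_compose2[of UNIV b]
          continuous_intros DERIV_continuous_on)
  have cz: "continuous_on J z" and cz1: "continuous_on J z1"
    using dz dz1 DERIV_continuous_on by blast+
  have comp: "continuous_on ?S (\<lambda>p. g (p $ 1))" if "continuous_on J g" for g :: "real \<Rightarrow> real"
    using that by (rule continuous_on_compose2) (auto simp: strip_def intro!: continuous_intros)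
  note cont = ca cb comp[OF cz] comp[OF cz1] comp[OF cz2]
  define F where "F s t = (vector [s * a t, s * b t, z s + c * t] :: real^3)" for s t
  define F1 where "F1 s t = (vector [a t, b t, z1 s] :: real^3)" for s t
  define F2 where "F2 s t = (vector [s * \<phi> * b t, s * \<phi> * a t, c] :: real^3)" for s t
  define F11 where "F11 s t = (vector [0, 0, z2 s] :: real^3)" for s t :: real
  define F12 where "F12 s t = (vector [\<phi> * b t, \<phi> * a t, 0] :: real^3)" for s t :: real
  define F22 where "F22 s t = (vector [s * \<phi>\<^sup>2 * a t, s * \<phi>\<^sup>2 * b t, 0] :: real^3)" for s t
  note Fdefs = F_def F1_def F2_def F11_def F12_def F22_def
  have d: "((\<lambda>s. F s t) has_vector_derivative F1 s t) (at s within J)"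
      "(F s has_vector_derivative F2 s t) (at t)"
      "((\<lambda>s. F1 s t) has_vector_derivative F11 s t) (at s within J)"
      "(F1 s has_vector_derivative F12 s t) (at t)"
      "((\<lambda>s. F2 s t) has_vector_derivative F12 s t) (at s within J)"
      "(F2 s has_vector_derivative F22 s t) (at t)" if "s \<in> J" for s t
    unfolding Fdefs
    by (rule has_vector_derivative_vector3;
        (auto intro!: derivative_eq_intros da db dz dz1 that simp: power2_eq_square))+
  have c: "continuous_on ?S (\<lambda>p. F (p $ 1) (p $ 2))"
      "continuous_on ?S (\<lambda>p. F1 (p $ 1) (p $ 2))"
      "continuous_on ?S (\<lambda>p. F2 (p $ 1) (p $ 2))"
      "continuous_on ?S (\<lambda>p. F11 (p $ 1) (p $ 2))"
      "continuous_on ?S (\<lambda>p. F12 (p $ 1) (p $ 2))"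
      "continuous_on ?S (\<lambda>p. F22 (p $ 1) (p $ 2))"
    unfolding Fdefs by (intro continuous_on_vector3 continuous_intros cont)+
  have fF: "f q = F (q $ 1) (q $ 2)" for q by (simp add: f F_def)
  have C1: "C1_surface_on ?S f"
    and pd1: "\<And>q. q \<in> ?S \<Longrightarrow> pder ?S f 1 q = F1 (q $ 1) (q $ 2)"
    and pd2: "\<And>q. q \<in> ?S \<Longrightarrow> pder ?S f 2 q = F2 (q $ 1) (q $ 2)"
    by (rule C1_surface_on_strip[OF perfect fF d(1,2) c(1-3)]; assumption)+
  have C1': "C1_surface_on ?S (pder ?S f 1)"
    and pd11: "\<And>q. q \<in> ?S \<Longrightarrow> pder ?S (pder ?S f 1) 1 q = F11 (q $ 1) (q $ 2)"
    and pd12: "\<And>q. q \<in> ?S \<Longrightarrow> pder ?S (pder ?S f 1) 2 q = F12 (q $ 1) (q $ 2)"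
    by (rule C1_surface_on_strip[OF perfect pd1 d(3,4) c(2,4,5)]; assumption)+
  have C1'': "C1_surface_on ?S (pder ?S f 2)"
    and pd22: "\<And>q. q \<in> ?S \<Longrightarrow> pder ?S (pder ?S f 2) 2 q = F22 (q $ 1) (q $ 2)"
    by (rule C1_surface_on_strip[OF perfect pd2 d(5,6) c(3,5,6)]; assumption)+
  have X12: "Xmin ?S f 1 2 p = \<epsilon> * p $ 1 * \<phi>" if "p \<in> ?S" for p
    unfolding unit[of "p $ 2", symmetric]
    by (simp add: Xmin_def pd1[OF that] pd2[OF that] F1_def F2_def algebra_simps power2_eq_square)
  show "admissible_surface_on ?S f"
    unfolding admissible_surface_on_def C2_surface_on_def forall_2
    using C1 C1' C1'' X12 \<open>\<phi> \<noteq> 0\<close> \<open>0 \<notin> J\<close> eps by (auto simp: strip_def)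
  fix s t assume "s \<in> J"
  define p :: "real^2" where "p = vector [s, t]"
  have p: "p \<in> ?S" "p $ 1 = s" "p $ 2 = t" using \<open>s \<in> J\<close> by (auto simp: p_def strip_def)
  have "s \<noteq> 0" "\<epsilon> \<noteq> 0" using \<open>s \<in> J\<close> \<open>0 \<notin> J\<close> eps by auto
  have pd: "pder ?S f 1 p = F1 s t" "pder ?S f 2 p = F2 s t"
    "pder2 ?S f 1 1 p = F11 s t" "pder2 ?S f 1 2 p = F12 s t" "pder2 ?S f 2 2 p = F22 s t"
    using pd1 pd2 pd11 pd12 pd22 p by (simp_all add: pder2_def)
  have g: "gcoef ?S f 1 1 p = \<epsilon>" "gcoef ?S f 1 2 p = 0" "gcoef ?S f 2 2 p = - \<epsilon> * (s * \<phi>)\<^sup>2"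
    by (simp_all add: gcoef_def pd pz_inner_def F1_def F2_def unit[of t, symmetric])
       (simp_all add: algebra_simps power2_eq_square)
  have X: "Xmin ?S f 1 2 p = \<epsilon> * s * \<phi>"
    "Xmin ?S f 2 3 p = c * b t - z1 s * s * \<phi> * a t"
    "Xmin ?S f 1 3 p = c * a t - z1 s * s * \<phi> * b t"
    using X12[OF p(1)] by (simp_all add: p Xmin_def pd F1_def F2_def algebra_simps)
  have h11: "hcoef ?S f 1 1 p = z2 s"
    by (simp add: hcoef_def pd inner1_def Nh_def F11_def)
  \<comment> \<open>In both numerators below the mixed terms in \<open>a t * b t\<close> cancel, leaving a multiple of
    \<open>(a t)\<^sup>2 - (b t)\<^sup>2\<close>.\<close>
  have "hcoef ?S f 1 2 p
      = (Xmin ?S f 2 3 p * b t - Xmin ?S f 1 3 p * a t) * \<phi> / Xmin ?S f 1 2 p"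
    by (simp add: hcoef_def pd inner1_def Nh_def F12_def algebra_simps diff_divide_distrib)
  also have "\<dots> = - (c * ((a t)\<^sup>2 - (b t)\<^sup>2)) * \<phi> / (\<epsilon> * s * \<phi>)"
    unfolding X by (simp add: algebra_simps power2_eq_square)
  also have "\<dots> = - c / s" using \<open>\<epsilon> \<noteq> 0\<close> \<open>\<phi> \<noteq> 0\<close> by (simp add: unit)
  finally have h12: "hcoef ?S f 1 2 p = - c / s" .
  have "hcoef ?S f 2 2 p
      = (Xmin ?S f 2 3 p * a t - Xmin ?S f 1 3 p * b t) * (s * \<phi>\<^sup>2) / Xmin ?S f 1 2 p"
    by (simp add: hcoef_def pd inner1_def Nh_def F22_def algebra_simps diff_divide_distrib)
  also have "\<dots> = - (z1 s * s * \<phi> * ((a t)\<^sup>2 - (b t)\<^sup>2)) * (s * \<phi>\<^sup>2) / (\<epsilon> * s * \<phi>)"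
    unfolding X by (simp add: algebra_simps power2_eq_square)
  also have "\<dots> = - (s * \<phi>\<^sup>2 * z1 s)"
    using \<open>\<epsilon> \<noteq> 0\<close> \<open>\<phi> \<noteq> 0\<close> \<open>s \<noteq> 0\<close> by (simp add: unit)
  finally have h22: "hcoef ?S f 2 2 p = - (s * \<phi>\<^sup>2 * z1 s)" .
  have "gauss_curvature ?S f p
      = (- (s * \<phi>\<^sup>2 * z1 s * z2 s) - c\<^sup>2 / s\<^sup>2) / (- (\<epsilon>\<^sup>2 * (s * \<phi>)\<^sup>2))"
    by (simp add: gauss_curvature_def g h11 h12 h22 power_divide power2_eq_square mult_ac)
  also have "\<dots> = z1 s * z2 s / s + c\<^sup>2 / (\<phi>\<^sup>2 * s ^ 4)"
    unfolding eps using \<open>s \<noteq> 0\<close> \<open>\<phi> \<noteq> 0\<close>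
    by (simp add: field_simps power2_eq_square power4_eq_xxxx)
  finally show "gauss_curvature ?S f (vector [s, t]) = z1 s * z2 s / s + c\<^sup>2 / (\<phi>\<^sup>2 * s ^ 4)"
    by (simp add: p_def)
qed

section \<open>The generating curve with prescribed curvature\<close>

definition profile :: "real \<Rightarrow> real \<Rightarrow> (real \<Rightarrow> real) \<Rightarrow> real \<Rightarrow> real \<Rightarrow> real \<Rightarrow> real \<Rightarrow> real" where
  "profile c \<phi> K s0 k0 k1 s = k0 + (LBINT v=s0..s. sqrt (radicand c \<phi> K s0 k1 v))"

text \<open>Half the derivative of the radicand, divided by its square root.\<close>

definition profile_deriv2 :: "real \<Rightarrow> real \<Rightarrow> (real \<Rightarrow> real) \<Rightarrow> real \<Rightarrow> real \<Rightarrow> real \<Rightarrow> real" where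
  "profile_deriv2 c \<phi> K s0 k1 s =
     (s * K s - c\<^sup>2 / (\<phi>\<^sup>2 * s ^ 3)) / sqrt (radicand c \<phi> K s0 k1 s)"

lemma radicand_self: "radicand c \<phi> K s0 k1 s0 = k1 + c\<^sup>2 / (\<phi>\<^sup>2 * s0\<^sup>2)"
  by (simp add: radicand_def)

lemma profile_self: "profile c \<phi> K s0 k0 k1 s0 = k0"
  by (simp add: profile_def)

lemma radicand_has_real_derivative:
  assumes "is_interval J" "s0 \<in> J" "s \<in> J" "s \<noteq> 0" "continuous_on J K" "\<phi> \<noteq> 0"
  shows "(radicand c \<phi> K s0 k1 has_real_derivative 2 * (s * K s - c\<^sup>2 / (\<phi>\<^sup>2 * s ^ 3)))
           (at s within J)"
proof -
  have "((\<lambda>v. LBINT w=s0..v. w * K w) has_real_derivative s * K s) (at s within J)"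
    using assms by (intro interval_integral_has_real_derivative continuous_intros)
  then show ?thesis
    unfolding radicand_def using assms(4,6)
    by (auto intro!: derivative_eq_intros simp: field_simps power2_eq_square power3_eq_cube)
qed

context
  fixes c \<phi> s0 k0 k1 :: real and K :: "real \<Rightarrow> real" and I J :: "real set"
  assumes phi: "\<phi> \<noteq> 0" and I: "I \<subseteq> {0<..}" and K: "continuous_on I K"
    and good: "good_interval c \<phi> K I s0 k1 J"
begin

lemma good_intervalD:
  shows "is_interval J" "s0 \<in> J" "s \<in> J \<Longrightarrow> s > 0" "s \<in> J \<Longrightarrow> radicand c \<phi> K s0 k1 s > 0"
    "s \<in> J \<Longrightarrow> at s within J \<noteq> bot" "continuous_on J K"
proof -
  have J: "is_interval J" "J \<subseteq> I" "s0 \<in> J" "J \<noteq> {s0}" "\<forall>v\<in>J. radicand c \<phi> K s0 k1 v > 0"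
    using good unfolding good_interval_def by blast+
  show "is_interval J" "s0 \<in> J" by fact+
  show "s > 0" if "s \<in> J" using that J(2) I by auto
  show "radicand c \<phi> K s0 k1 s > 0" if "s \<in> J" using that J(5) by simp
  show "at s within J \<noteq> bot" if "s \<in> J" by (rule interval_islimpt[OF J(1,3,4) that])
  show "continuous_on J K" by (rule continuous_on_subset[OF K J(2)])
qed

lemma continuous_on_sqrt_radicand: "continuous_on J (\<lambda>s. sqrt (radicand c \<phi> K s0 k1 s))"
proof -
  have "(radicand c \<phi> K s0 k1 has_real_derivative 2 * (s * K s - c\<^sup>2 / (\<phi>\<^sup>2 * s ^ 3)))
           (at s within J)" if "s \<in> J" for s
    using good_intervalD(3)[OF that]
    by (intro radicand_has_real_derivative good_intervalD(1,2,6) that phi) simp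
  then show ?thesis by (intro continuous_on_real_sqrt) (rule DERIV_continuous_on)
qed

lemma profile_has_real_derivative:
  assumes "s \<in> J"
  shows "(profile c \<phi> K s0 k0 k1 has_real_derivative sqrt (radicand c \<phi> K s0 k1 s))
           (at s within J)"
  unfolding profile_def
  using interval_integral_has_real_derivative[OF good_intervalD(1,2) assms continuous_on_sqrt_radicand]
  by (auto intro!: derivative_eq_intros)

lemma sqrt_radicand_has_real_derivative:
  assumes "s \<in> J"
  shows "((\<lambda>s. sqrt (radicand c \<phi> K s0 k1 s)) has_real_derivative profile_deriv2 c \<phi> K s0 k1 s)
           (at s within J)"
proof -
  note r = good_intervalD(4)[OF assms]
  have "(radicand c \<phi> K s0 k1 has_real_derivative 2 * (s * K s - c\<^sup>2 / (\<phi>\<^sup>2 * s ^ 3)))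
           (at s within J)"
    using good_intervalD(3)[OF assms]
    by (intro radicand_has_real_derivative good_intervalD(1,2,6) assms phi) simp
  from DERIV_chain2[OF DERIV_real_sqrt[OF r] this] show ?thesis
    by (rule DERIV_cong) (use r in \<open>simp add: profile_deriv2_def divide_simps\<close>)
qed

lemma continuous_on_profile_deriv2: "continuous_on J (profile_deriv2 c \<phi> K s0 k1)"
proof -
  have "s \<noteq> 0" "sqrt (radicand c \<phi> K s0 k1 s) \<noteq> 0" if "s \<in> J" for s
    using good_intervalD(3,4)[OF that] by simp_all
  then show ?thesis
    unfolding profile_deriv2_def using phi
    by (intro continuous_intros good_intervalD(6) continuous_on_sqrt_radicand) simp_all
qed

text \<open>This is the differential equation for the height, in the form in which the curvature formula for
  helicoidal surfaces produces it.\<close>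

lemma profile_curvature_equation:
  assumes "s \<in> J"
  shows "sqrt (radicand c \<phi> K s0 k1 s) * profile_deriv2 c \<phi> K s0 k1 s / s
           + c\<^sup>2 / (\<phi>\<^sup>2 * s ^ 4) = K s"
proof -
  have pos: "s \<noteq> 0" "sqrt (radicand c \<phi> K s0 k1 s) \<noteq> 0"
    using good_intervalD(3,4)[OF assms] by simp_all
  then have "sqrt (radicand c \<phi> K s0 k1 s) * profile_deriv2 c \<phi> K s0 k1 s
      = s * K s - c\<^sup>2 / (\<phi>\<^sup>2 * s ^ 3)"
    by (simp add: profile_deriv2_def)
  then show ?thesis
    using pos(1) phi by (simp add: diff_divide_distrib power3_eq_cube power4_eq_xxxx mult_ac)
qed

text \<open>The pair \<open>(e1, e2)\<close> is \<open>(1, 0)\<close> for spacelike and \<open>(0, 1)\<close> for timelike generating curves.\<close>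

lemma curve_with_profile:
  fixes \<alpha> :: "real \<Rightarrow> real^3"
  assumes \<alpha>: "\<And>s. \<alpha> s = vector [e1 * s, e2 * s, profile c \<phi> K s0 k0 k1 s]"
  shows "C2_curve_on J \<alpha>"
    and "s \<in> J \<Longrightarrow> velocity J \<alpha> s = vector [e1, e2, sqrt (radicand c \<phi> K s0 k1 s)]"
proof -
  have d1: "(\<alpha> has_vector_derivative vector [e1, e2, sqrt (radicand c \<phi> K s0 k1 s)])
      (at s within J)" if "s \<in> J" for s
    unfolding \<alpha> using profile_has_real_derivative[OF that]
    by (intro has_vector_derivative_vector3) (auto intro!: derivative_eq_intros)
  have v1: "velocity J \<alpha> s = vector [e1, e2, sqrt (radicand c \<phi> K s0 k1 s)]" if "s \<in> J" for s
    unfolding velocity_def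
    using good_intervalD(5)[OF that] d1[OF that] by (rule vector_derivative_within)
  then show "s \<in> J \<Longrightarrow> velocity J \<alpha> s = vector [e1, e2, sqrt (radicand c \<phi> K s0 k1 s)]" .
  have d2: "(velocity J \<alpha> has_vector_derivative vector [0, 0, profile_deriv2 c \<phi> K s0 k1 s])
      (at s within J)" if "s \<in> J" for s
  proof (rule has_vector_derivative_transform[OF that v1])
    show "((\<lambda>s. vector [e1, e2, sqrt (radicand c \<phi> K s0 k1 s)]) has_vector_derivative
        (vector [0, 0, profile_deriv2 c \<phi> K s0 k1 s] :: real^3)) (at s within J)"
      using sqrt_radicand_has_real_derivative[OF that]
      by (intro has_vector_derivative_vector3) auto
  qed
  have v2: "velocity J (velocity J \<alpha>) s = vector [0, 0, profile_deriv2 c \<phi> K s0 k1 s]"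
    if "s \<in> J" for s
    unfolding velocity_def[of J "velocity J \<alpha>"]
    using good_intervalD(5)[OF that] d2[OF that] by (rule vector_derivative_within)
  have "continuous_on J (velocity J (velocity J \<alpha>))"
    by (subst continuous_on_cong[OF refl v2])
       (auto intro!: continuous_on_vector3 continuous_on_profile_deriv2)
  then show "C2_curve_on J \<alpha>"
    unfolding C2_curve_on_def differentiable_on_def
    using d1 d2 by (blast intro: differentiableI_vector)
qed

lemma helicoid_with_profile:
  fixes a b :: "real \<Rightarrow> real"
  assumes "\<And>t. (a has_real_derivative \<phi> * b t) (at t)"
    and "\<And>t. (b has_real_derivative \<phi> * a t) (at t)"
    and "\<And>t. (a t)\<^sup>2 - (b t)\<^sup>2 = \<epsilon>" and "\<epsilon>\<^sup>2 = 1"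
    and "\<And>p. f p = vector [p $ 1 * a (p $ 2), p $ 1 * b (p $ 2),
                           profile c \<phi> K s0 k0 k1 (p $ 1) + c * p $ 2]"
  shows "admissible_surface_on (strip J) f"
    and "s \<in> J \<Longrightarrow> gauss_curvature (strip J) f (vector [s, t]) = K s"
proof -
  have "0 \<notin> J" using good_intervalD(3) by blast
  note H = helicoid_admissible_gauss_curvature[OF good_intervalD(5) this phi assms(1-4)
      profile_has_real_derivative sqrt_radicand_has_real_derivative
      continuous_on_profile_deriv2 assms(5)]
  show "admissible_surface_on (strip J) f" by (rule H(1))
  show "s \<in> J \<Longrightarrow> gauss_curvature (strip J) f (vector [s, t]) = K s"
    using H(2)[of s t] profile_curvature_equation[of s] by (simp only:)
qed

end

text \<open>The radicand is continuous within \<open>I\<close> and positive at \<open>s0\<close>, hence positive on a relative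
  neighbourhood of \<open>s0\<close>. That neighbourhood is nondegenerate because \<open>s0\<close> is a limit point of \<open>I\<close>.\<close>

lemma good_interval_exists:
  assumes "\<phi> \<noteq> 0" "is_interval I" "I \<subseteq> {0<..}" "s0 \<in> I" "I \<noteq> {s0}" "continuous_on I K"
    and pos: "k1 + c\<^sup>2 / (\<phi>\<^sup>2 * s0\<^sup>2) > 0"
  shows "\<exists>J. good_interval c \<phi> K I s0 k1 J \<and> openin (top_of_set I) J"
proof -
  have "s0 \<noteq> 0" using assms(3,4) by auto
  have "(radicand c \<phi> K s0 k1 \<longlongrightarrow> radicand c \<phi> K s0 k1 s0) (at s0 within I)"
    using DERIV_continuous[OF radicand_has_real_derivative[OF assms(2,4,4) \<open>s0 \<noteq> 0\<close> assms(6,1)]]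
    by (simp only: continuous_within)
  then have "\<forall>\<^sub>F v in at s0 within I. radicand c \<phi> K s0 k1 v > 0"
    by (rule order_tendstoD) (simp only: radicand_self pos)
  then obtain \<delta> where \<delta>: "\<delta> > 0"
      "\<And>v. v \<in> I \<Longrightarrow> v \<noteq> s0 \<Longrightarrow> dist v s0 < \<delta> \<Longrightarrow> radicand c \<phi> K s0 k1 v > 0"
    unfolding eventually_at by blast
  define J where "J = I \<inter> ball s0 \<delta>"
  have "is_interval J" unfolding J_def by (rule is_interval_Int[OF assms(2) is_interval_ball_real])
  moreover have "radicand c \<phi> K s0 k1 v > 0" if "v \<in> J" for v
  proof (cases "v = s0")
    case True
    then show ?thesis using pos by (simp only: radicand_self)
  next
    case False
    then show ?thesis using \<delta>(2)[of v] that by (simp add: J_def dist_commute)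
  qed
  moreover have "J \<noteq> {s0}"
  proof -
    have "s0 islimpt I" using interval_islimpt[OF assms(2,4,5,4)] by (simp add: trivial_limit_within)
    then obtain v where "v \<in> I" "v \<noteq> s0" "dist v s0 < \<delta>"
      using \<delta>(1) unfolding islimpt_approachable by blast
    then have "v \<in> J" by (simp add: J_def dist_commute)
    then show ?thesis using \<open>v \<noteq> s0\<close> by blast
  qed
  moreover have "openin (top_of_set I) J" unfolding J_def by (intro openin_open_Int) simp
  moreover have "s0 \<in> J" "J \<subseteq> I" using assms(4) \<delta>(1) by (auto simp: J_def)
  ultimately show ?thesis unfolding good_interval_def by blast
qed

section \<open>Helicoidal surfaces of prescribed Gaussian curvature\<close>

theorem theorem6p3:
  fixes c \<phi> s0 :: real and K :: "real \<Rightarrow> real" and I :: "real set"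
  assumes "\<phi> \<noteq> 0"
    and "is_interval I" and "I \<subseteq> {0<..}" and "s0 \<in> I" and "I \<noteq> {s0}"
    and "continuous_on I K"
  shows "(\<forall>k1. k1 + c\<^sup>2 / (\<phi>\<^sup>2 * s0\<^sup>2) > 0 \<longrightarrow>
            (\<exists>J. good_interval c \<phi> K I s0 k1 J \<and> openin (top_of_set I) J))
       \<and> (\<exists>\<alpha> :: real \<Rightarrow> real \<Rightarrow> real \<Rightarrow> real^3.
            \<forall>k0 k1 J. good_interval c \<phi> K I s0 k1 J \<longrightarrow>
              C2_curve_on J (\<alpha> k0 k1) \<and> arc_length_on J (\<alpha> k0 k1)
              \<and> admissible_surface_on (strip J) (Zh2 c \<phi> (\<alpha> k0 k1))
              \<and> (\<forall>s\<in>J. \<forall>t. gauss_curvature (strip J) (Zh2 c \<phi> (\<alpha> k0 k1)) (vector [s, t]) = K s)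
              \<and> (\<forall>s\<in>J. \<alpha> k0 k1 s =
                    vector [s, 0, k0 + (LBINT v=s0..s. sqrt (radicand c \<phi> K s0 k1 v))])
              \<and> k0 = \<alpha> k0 k1 s0 $ 3
              \<and> k1 = (velocity J (\<alpha> k0 k1) s0 $ 3)\<^sup>2 - c\<^sup>2 / (\<phi>\<^sup>2 * s0\<^sup>2))
       \<and> (\<exists>\<alpha> :: real \<Rightarrow> real \<Rightarrow> real \<Rightarrow> real^3.
            \<forall>k0 k1 J. good_interval c \<phi> K I s0 k1 J \<longrightarrow>
              C2_curve_on J (\<alpha> k0 k1) \<and> arc_length_on J (\<alpha> k0 k1)
              \<and> admissible_surface_on (strip J) (Wh2 c \<phi> (\<alpha> k0 k1))
              \<and> (\<forall>s\<in>J. \<forall>t. gauss_curvature (strip J) (Wh2 c \<phi> (\<alpha> k0 k1)) (vector [s, t]) = K s)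
              \<and> (\<forall>s\<in>J. \<alpha> k0 k1 s =
                    vector [0, s, k0 + (LBINT v=s0..s. sqrt (radicand c \<phi> K s0 k1 v))])
              \<and> k0 = \<alpha> k0 k1 s0 $ 3
              \<and> k1 = (velocity J (\<alpha> k0 k1) s0 $ 3)\<^sup>2 - c\<^sup>2 / (\<phi>\<^sup>2 * s0\<^sup>2))"
proof (intro conjI)
  show "\<forall>k1. k1 + c\<^sup>2 / (\<phi>\<^sup>2 * s0\<^sup>2) > 0 \<longrightarrow>
      (\<exists>J. good_interval c \<phi> K I s0 k1 J \<and> openin (top_of_set I) J)"
    using good_interval_exists[OF assms] by blast
next
  let ?\<alpha> = "\<lambda>k0 k1 s. vector [s, 0, profile c \<phi> K s0 k0 k1 s] :: real^3"
  show "\<exists>\<alpha> :: real \<Rightarrow> real \<Rightarrow> real \<Rightarrow> real^3.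
      \<forall>k0 k1 J. good_interval c \<phi> K I s0 k1 J \<longrightarrow>
        C2_curve_on J (\<alpha> k0 k1) \<and> arc_length_on J (\<alpha> k0 k1)
        \<and> admissible_surface_on (strip J) (Zh2 c \<phi> (\<alpha> k0 k1))
        \<and> (\<forall>s\<in>J. \<forall>t. gauss_curvature (strip J) (Zh2 c \<phi> (\<alpha> k0 k1)) (vector [s, t]) = K s)
        \<and> (\<forall>s\<in>J. \<alpha> k0 k1 s =
              vector [s, 0, k0 + (LBINT v=s0..s. sqrt (radicand c \<phi> K s0 k1 v))])
        \<and> k0 = \<alpha> k0 k1 s0 $ 3
        \<and> k1 = (velocity J (\<alpha> k0 k1) s0 $ 3)\<^sup>2 - c\<^sup>2 / (\<phi>\<^sup>2 * s0\<^sup>2)"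
  proof (intro exI[of _ ?\<alpha>] allI impI)
    fix k0 k1 J assume good: "good_interval c \<phi> K I s0 k1 J"
    note ctx = assms(1,3,6) good
    note D = good_intervalD[OF ctx]
    note C = curve_with_profile[OF ctx, of "?\<alpha> k0 k1" 1 0 k0, simplified]
    note H = helicoid_with_profile[OF ctx, of "\<lambda>t. cosh (t * \<phi>)" "\<lambda>t. sinh (t * \<phi>)" 1
        "Zh2 c \<phi> (?\<alpha> k0 k1)" k0]
    have H': "admissible_surface_on (strip J) (Zh2 c \<phi> (?\<alpha> k0 k1))"
      "s \<in> J \<Longrightarrow> gauss_curvature (strip J) (Zh2 c \<phi> (?\<alpha> k0 k1)) (vector [s, t]) = K s" for s t
      by (rule H; auto intro!: derivative_eq_intros simp: cosh_square_eq Zh2_def)+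
    show "C2_curve_on J (?\<alpha> k0 k1) \<and> arc_length_on J (?\<alpha> k0 k1)
        \<and> admissible_surface_on (strip J) (Zh2 c \<phi> (?\<alpha> k0 k1))
        \<and> (\<forall>s\<in>J. \<forall>t. gauss_curvature (strip J) (Zh2 c \<phi> (?\<alpha> k0 k1)) (vector [s, t]) = K s)
        \<and> (\<forall>s\<in>J. ?\<alpha> k0 k1 s =
              vector [s, 0, k0 + (LBINT v=s0..s. sqrt (radicand c \<phi> K s0 k1 v))])
        \<and> k0 = ?\<alpha> k0 k1 s0 $ 3
        \<and> k1 = (velocity J (?\<alpha> k0 k1) s0 $ 3)\<^sup>2 - c\<^sup>2 / (\<phi>\<^sup>2 * s0\<^sup>2)"
      using C(1) H' D(4)[OF D(2)]
      by (auto simp: arc_length_on_def C(2) D(2) pz_inner_def profile_self radicand_self)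
         (simp add: profile_def)
  qed
next
  let ?\<alpha> = "\<lambda>k0 k1 s. vector [0, s, profile c \<phi> K s0 k0 k1 s] :: real^3"
  show "\<exists>\<alpha> :: real \<Rightarrow> real \<Rightarrow> real \<Rightarrow> real^3.
      \<forall>k0 k1 J. good_interval c \<phi> K I s0 k1 J \<longrightarrow>
        C2_curve_on J (\<alpha> k0 k1) \<and> arc_length_on J (\<alpha> k0 k1)
        \<and> admissible_surface_on (strip J) (Wh2 c \<phi> (\<alpha> k0 k1))
        \<and> (\<forall>s\<in>J. \<forall>t. gauss_curvature (strip J) (Wh2 c \<phi> (\<alpha> k0 k1)) (vector [s, t]) = K s)
        \<and> (\<forall>s\<in>J. \<alpha> k0 k1 s =
              vector [0, s, k0 + (LBINT v=s0..s. sqrt (radicand c \<phi> K s0 k1 v))])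
        \<and> k0 = \<alpha> k0 k1 s0 $ 3
        \<and> k1 = (velocity J (\<alpha> k0 k1) s0 $ 3)\<^sup>2 - c\<^sup>2 / (\<phi>\<^sup>2 * s0\<^sup>2)"
  proof (intro exI[of _ ?\<alpha>] allI impI)
    fix k0 k1 J assume good: "good_interval c \<phi> K I s0 k1 J"
    note ctx = assms(1,3,6) good
    note D = good_intervalD[OF ctx]
    note C = curve_with_profile[OF ctx, of "?\<alpha> k0 k1" 0 1 k0, simplified]
    note H = helicoid_with_profile[OF ctx, of "\<lambda>t. sinh (t * \<phi>)" "\<lambda>t. cosh (t * \<phi>)" "-1"
        "Wh2 c \<phi> (?\<alpha> k0 k1)" k0]
    have H': "admissible_surface_on (strip J) (Wh2 c \<phi> (?\<alpha> k0 k1))"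
      "s \<in> J \<Longrightarrow> gauss_curvature (strip J) (Wh2 c \<phi> (?\<alpha> k0 k1)) (vector [s, t]) = K s" for s t
      by (rule H; auto intro!: derivative_eq_intros simp: cosh_square_eq Wh2_def)+
    show "C2_curve_on J (?\<alpha> k0 k1) \<and> arc_length_on J (?\<alpha> k0 k1)
        \<and> admissible_surface_on (strip J) (Wh2 c \<phi> (?\<alpha> k0 k1))
        \<and> (\<forall>s\<in>J. \<forall>t. gauss_curvature (strip J) (Wh2 c \<phi> (?\<alpha> k0 k1)) (vector [s, t]) = K s)
        \<and> (\<forall>s\<in>J. ?\<alpha> k0 k1 s =
              vector [0, s, k0 + (LBINT v=s0..s. sqrt (radicand c \<phi> K s0 k1 v))])
        \<and> k0 = ?\<alpha> k0 k1 s0 $ 3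
        \<and> k1 = (velocity J (?\<alpha> k0 k1) s0 $ 3)\<^sup>2 - c\<^sup>2 / (\<phi>\<^sup>2 * s0\<^sup>2)"
      using C(1) H' D(4)[OF D(2)]
      by (auto simp: arc_length_on_def C(2) D(2) pz_inner_def profile_self radicand_self)
         (simp add: profile_def)
  qed
qed

end
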